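(* Let $n\ge 1$ be an integer and suppose that $S=\sum_{i=1}^n X_i$ is a sum of independent real-valued random variables with $\mathbb{P}(0\le X_i\le 1)=1$ for $1\le i\le n$. Let $r=1-a_0=0.841405\dots$, where $a_0$ is the unique solution in $(0,1]$ of $a_0=e^{a_0-2}$. Then $$\mathbb{P}(S\le 1)\le e^{1-r\,\mathbb{E}S},$$ or equivalently $$\mathbb{E}S\le \frac{1}{r}\bigl(1-\log\mathbb{P}(S\le 1)\bigr).$$
   Context: Here $\log$ is the natural logarithm, with $\log 0=-\infty$, so that the second inequality is trivially true when $\mathbb{P}(S\le 1)=0$. *)

theory Defs
  imports "HOL-Probability.Probability"
begin

definition a0 :: real where
  "a0 = (THE a. a \<in> {0<..1} \<and> a = exp (a - 2))"

definition r :: real where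
  "r = 1 - a0"

text \<open>Natural logarithm on \<open>[0, \<infinity>)\<close> with \<open>log 0 = -\<infinity>\<close> (the library's \<open>ln\<close> is real-valued at \<open>0\<close>).\<close>

definition ln_ext :: "real \<Rightarrow> ereal" where
  "ln_ext x = (if x = 0 then -\<infinity> else ereal (ln x))"

end

theory Submission
  imports Defs
begin

text \<open>
  The bound is approached by sums of rare jumps of size 1: in the Poisson limit with total mean
  \<open>\<mu>\<close> they give probability \<open>(1 + \<mu>) e\<^sup>-\<^sup>\<mu>\<close>, and \<open>1 + \<mu> \<le> e\<^bsup>1 + (1 - r) \<mu>\<^esup>\<close> is the tangent inequality of the
  exponential at \<open>1 + \<mu> = 1 / (1 - r)\<close>; the equation \<open>e\<^bsup>-(1 + r)\<^esup> = 1 - r\<close> defining \<open>r\<close> makes the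
  constant come out as exactly \<open>e\<close>. The proof transports this computation to arbitrary laws.

  To each variable \<open>X\<^sub>i\<close> attach two nonnegative functions \<open>u\<^sub>i\<close> and \<open>w\<^sub>i\<close> on \<open>[0, 1]\<close>, where \<open>u\<^sub>i\<close> stands
  for "\<open>X\<^sub>i\<close> did not jump" and \<open>w\<^sub>i\<close> for "\<open>X\<^sub>i\<close> made the one allowed jump". If
  \<^item> \<open>\<Prod>\<^sub>i u\<^sub>i(x\<^sub>i) + \<Sum>\<^sub>i w\<^sub>i(x\<^sub>i) \<Prod>\<^sub>j\<^sub>\<noteq>\<^sub>i u\<^sub>j(x\<^sub>j) \<ge> 1\<close> whenever \<open>x\<^sub>1 + \<dots> + x\<^sub>n \<le> 1\<close>,

  then taking expectations gives, with \<open>A\<^sub>i = E u\<^sub>i(X\<^sub>i)\<close> and \<open>B\<^sub>i = E w\<^sub>i(X\<^sub>i)\<close>,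
  \<open>P(S \<le> 1) \<le> \<Prod>A\<^sub>i (1 + \<Sum>B\<^sub>i/A\<^sub>i) \<le> e \<Prod>(A\<^sub>i e\<^bsup>(1 - r) B\<^sub>i/A\<^sub>i\<^esup>)\<close>, where the last step is the tangent
  inequality above. So it is enough that
  \<^item> \<open>ln A\<^sub>i + (1 - r) B\<^sub>i/A\<^sub>i \<le> - r E X\<^sub>i\<close> for each single \<open>i\<close>.

  The first requirement is organised by the threshold \<open>1/2\<close>, because at most one summand exceeds it:
  below the threshold the weights dominate \<open>u(x) = (1 - r)\<^sup>x\<close>, \<open>w(x) = \<lambda> x u(x)\<close> with
  \<open>\<lambda> = r/(1 - r)\<close> (the extremal Poisson mean), and above it two scalar inequalities
  suffice (\<open>weight_certificate\<close>).

  Laws that jump to \<open>x\<close> with small probability force \<open>u(x) + (1 - r) w(x) \<le> 1 - r x\<close>;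
  since \<open>u(1) + w(1) \<ge> 1\<close>, this gives \<open>u(1) = 0\<close>, which is useless for \<open>X\<^sub>i = 1\<close>; so the pair has to depend on the mean of \<open>X\<^sub>i\<close>. For
  means up to \<open>1/2\<close> the pair \<open>u_small\<close>, \<open>w_small\<close> attains equality in that condition
  (\<open>small_mean_bound\<close>). A law with larger mean behaves more like a
  constant, and the exponential weights \<open>u_large(x) = (1 - r)\<^sup>x\<close> work (\<open>large_mean_bound\<close>).
\<close>

section \<open>The constant r\<close>

text \<open>The two numerical facts below place the solution of \<open>a = e\<^bsup>a - 2\<^esup>\<close> between \<open>0.158594\<close> and
  \<open>0.158595\<close>; the relative margin is about \<open>2 \<cdot> 10\<^bsup>-6\<^esup>\<close>, and 13 terms of the exponential series
  resolve it.\<close>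

lemma exp_upper: "exp (1.841406::real) < 1 / 0.158594"
proof -
  obtain t where t: "\<bar>t\<bar> \<le> \<bar>1.841406::real\<bar>"
    "exp (1.841406::real) = (\<Sum>k<13. 1.841406 ^ k / fact k) + exp t / fact 13 * 1.841406 ^ 13"
    using Maclaurin_exp_le by blast
  have "exp t \<le> exp (1 + 1)" using t(1) by simp
  also have "\<dots> = exp 1 * exp (1::real)" by (rule exp_add)
  also have "\<dots> \<le> 3 * 3" using exp_le by (intro mult_mono) auto
  finally have "exp t / fact 13 * 1.841406 ^ 13 \<le> 9 / fact 13 * (1.841406::real) ^ 13"
    by (intro mult_right_mono divide_right_mono) auto
  then show ?thesis unfolding t(2) by (simp add: eval_nat_numeral fact_numeral)
qed

lemma exp_lower: "1 / 0.158595 < exp (1.841405::real)"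
proof -
  obtain t where t: "\<bar>t\<bar> \<le> \<bar>1.841405::real\<bar>"
    "exp (1.841405::real) = (\<Sum>k<13. 1.841405 ^ k / fact k) + exp t / fact 13 * 1.841405 ^ 13"
    using Maclaurin_exp_le by blast
  have "1 / 0.158595 < (\<Sum>k<13. (1.841405::real) ^ k / fact k)"
    by (simp add: eval_nat_numeral fact_numeral)
  also have "\<dots> \<le> exp 1.841405" unfolding t(2) by simp
  finally show ?thesis .
qed

lemma fixed_point_enclosure:
  "\<exists>a::real. 0.158594 < a \<and> a < 0.158595 \<and> a = exp (a - 2)"
proof -
  define f :: "real \<Rightarrow> real" where "f = (\<lambda>a. a - exp (a - 2))"
  have "inverse (1 / 0.158594) < inverse (exp (1.841406::real))"
    using exp_upper by (rule less_imp_inverse_less) (rule exp_gt_zero)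
  also have "inverse (exp (1.841406::real)) = exp (0.158594 - 2)"
    unfolding exp_minus[symmetric] by (rule arg_cong[of _ _ exp]) simp
  finally have l: "f 0.158594 < 0" unfolding f_def by simp
  have "inverse (exp (1.841405::real)) < inverse (1 / 0.158595)"
    using exp_lower by (rule less_imp_inverse_less) simp
  also have "inverse (exp (1.841405::real)) = exp (0.158595 - 2)"
    unfolding exp_minus[symmetric] by (rule arg_cong[of _ _ exp]) simp
  finally have u: "f 0.158595 > 0" unfolding f_def by simp
  have "\<exists>a. 0.158594 \<le> a \<and> a \<le> 0.158595 \<and> f a = 0"
  proof (rule IVT')
    show "continuous_on {0.158594..0.158595} f"
      unfolding f_def by (intro continuous_intros)
  qed (use l u in \<open>simp_all add: less_imp_le\<close>)
  then obtain a where a: "0.158594 \<le> a" "a \<le> 0.158595" "f a = 0" by blast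
  have "a \<noteq> 0.158594" "a \<noteq> 0.158595" using a(3) l u by (metis less_irrefl)+
  moreover have "a = exp (a - 2)" using a(3) unfolding f_def by linarith
  ultimately show ?thesis using a(1,2) by (intro exI[of _ a] conjI) linarith+
qed

lemma fixed_point_ex1: "\<exists>!a::real. a \<in> {0<..1} \<and> a = exp (a - 2)"
proof (rule ex_ex1I)
  show "\<exists>a::real. a \<in> {0<..1} \<and> a = exp (a - 2)"
  proof -
    obtain a :: real where a: "0.158594 < a" "a < 0.158595" "a = exp (a - 2)"
      using fixed_point_enclosure by blast
    have "a \<in> {0<..1}" using a(1,2) by simp
    with a(3) show ?thesis by blast
  qed
next
  \<comment> \<open>The map \<open>a \<mapsto> exp (a - 2)\<close> is a strict contraction to the left of 2.\<close>
  have less: "exp (b - 2) - exp (a - 2) < b - a" if "a < b" "b \<le> 1" for a b :: real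
  proof -
    have "1 + (a - b) \<le> exp (a - b)" by (rule exp_ge_add_one_self)
    then have "exp (b - 2) * (1 - exp (a - b)) \<le> exp (b - 2) * (b - a)"
      by (intro mult_left_mono) (linarith, simp)
    also have "\<dots> < 1 * (b - a)"
      using that by (intro mult_strict_right_mono) auto
    finally show ?thesis
      by (simp add: algebra_simps flip: exp_add)
  qed
  fix a b :: real
  assume a: "a \<in> {0<..1} \<and> a = exp (a - 2)" and b: "b \<in> {0<..1} \<and> b = exp (b - 2)"
  have "exp (a - 2) = a" "exp (b - 2) = b" "a \<le> 1" "b \<le> 1" using a b by simp_all
  then show "a = b" using less[of a b] less[of b a]
    by (cases a b rule: linorder_cases) simp_all
qed

lemma a0_fixed_point: "a0 = exp (a0 - 2)"
  using theI'[OF fixed_point_ex1] unfolding a0_def by (rule conjunct2)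

lemma r_gt: "0.841405 < r" and r_less: "r < 0.841406"
proof -
  obtain a :: real where a: "0.158594 < a" "a < 0.158595" "a = exp (a - 2)"
    using fixed_point_enclosure by blast
  have "a0 = a"
    unfolding a0_def using a(1,2)
    by (intro the1_equality[OF fixed_point_ex1] conjI a(3)) simp
  then show "0.841405 < r" "r < 0.841406" using a(1,2) by (simp_all add: r_def)
qed

lemma exp_r: "exp (- (1 + r)) = 1 - r"
  using a0_fixed_point[symmetric] by (simp add: r_def)

section \<open>Weights that certify a sum of at most 1\<close>

lemma one_le_exp_minus_mult:
  fixes l s t :: real
  assumes "exp (l * s) \<le> t"
  shows "1 \<le> exp (- l * s) * t"
proof -
  have "1 = exp (- l * s) * exp (l * s)" by (simp flip: exp_add)
  also have "\<dots> \<le> exp (- l * s) * t" using assms by (intro mult_left_mono) auto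
  finally show ?thesis .
qed

text \<open>Convexity in the form used throughout: to bound an exponential by an affine function on an
  interval it is enough to look at the two endpoints.\<close>

lemma exp_le_affine:
  fixes l :: real
  assumes "a \<le> s" "s \<le> b" "exp (l * a) \<le> c + k * a" "exp (l * b) \<le> c + k * b"
  shows "exp (l * s) \<le> c + k * s"
proof (cases "a = b")
  case True
  then show ?thesis using assms by auto
next
  case False
  define q where "q = (s - a) / (b - a)"
  have q: "0 \<le> q" "q \<le> 1" "q * (b - a) = s - a"
    using assms(1,2) False by (auto simp: q_def field_simps)
  have s: "s = (1 - q) * a + q * b" using q(3) by (simp add: algebra_simps)
  have "exp ((1 - q) *\<^sub>R (l * a) + q *\<^sub>R (l * b)) \<le> (1 - q) * exp (l * a) + q * exp (l * b)"
    using q by (intro convex_onD[OF exp_convex]) auto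
  also have "\<dots> \<le> (1 - q) * (c + k * a) + q * (c + k * b)"
    using q assms by (intro add_mono mult_left_mono) auto
  also have "\<dots> = c + k * s" by (simp add: s algebra_simps)
  finally show ?thesis by (simp add: s algebra_simps)
qed

text \<open>The mean at which the Poisson law attains the bound.\<close>

definition lam :: real where
  "lam = r / (1 - r)"

lemma lam_pos: "0 < lam"
  using r_gt r_less by (simp add: lam_def)

lemma one_plus_lam: "1 + lam = exp (1 + r)"
proof -
  have "exp (1 + r) = inverse (exp (- (1 + r)))" by (simp only: exp_minus inverse_inverse_eq)
  also have "\<dots> = 1 / (1 - r)" by (simp only: exp_r divide_inverse mult_1)
  finally show ?thesis using r_less by (simp add: lam_def field_simps)
qed

text \<open>The conditions on a pair of weights that make \<open>weight_certificate\<close> true. The condition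
  above \<open>1/2\<close> says that the weighted sum is at least 1 when the other summands add up to the
  least possible value 0 or to the greatest possible value \<open>1 - x\<close>; exponentials are written
  via \<open>e\<^bsup>-(1 + r)\<^esup> = 1 - r\<close>. The upper bounds give integrability.\<close>

definition weight_pair :: "(real \<Rightarrow> real) \<Rightarrow> (real \<Rightarrow> real) \<Rightarrow> bool" where
  "weight_pair u w \<longleftrightarrow>
     u \<in> borel_measurable borel \<and> w \<in> borel_measurable borel \<and>
     (\<forall>x\<in>{0..1}. 0 \<le> u x \<and> u x \<le> 1 \<and> 0 \<le> w x \<and> w x \<le> 1 + lam) \<and>
     (\<forall>x\<in>{0..1/2}. exp (- (1 + r) * x) \<le> u x \<and> w x = lam * x * u x) \<and>
     (\<forall>x\<in>{1/2<..1}. 1 \<le> u x + w x \<and>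
        exp ((1 + r) * (1 - x)) \<le> u x * (1 + lam * (1 - x)) + w x)"

text \<open>When no summand exceeds \<open>1/2\<close>, the proportionality \<open>w x = lam * x * u x\<close> makes the
  weighted sum depend on the points only through their sum and the product of the \<open>u\<close>.\<close>

lemma small_weights:
  assumes "\<And>i. i \<in> I \<Longrightarrow> weight_pair (u i) (w i)" "finite I"
    and "\<And>i. i \<in> I \<Longrightarrow> 0 \<le> x i \<and> x i \<le> 1 / 2"
  shows "exp (- (1 + r) * (\<Sum>i\<in>I. x i)) \<le> (\<Prod>i\<in>I. u i (x i))"
    and "(\<Sum>i\<in>I. w i (x i) * (\<Prod>j\<in>I - {i}. u j (x j)))
           = lam * (\<Sum>i\<in>I. x i) * (\<Prod>i\<in>I. u i (x i))"
proof -
  have *: "exp (- (1 + r) * x i) \<le> u i (x i)" "w i (x i) = lam * x i * u i (x i)" if "i \<in> I" for i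
    using assms(1)[OF that] assms(3)[OF that] by (auto simp: weight_pair_def)
  have "exp (- (1 + r) * (\<Sum>i\<in>I. x i)) = (\<Prod>i\<in>I. exp (- (1 + r) * x i))"
    using assms(2) by (simp add: exp_sum sum_distrib_left)
  also have "\<dots> \<le> (\<Prod>i\<in>I. u i (x i))"
    using * by (intro prod_mono) auto
  finally show "exp (- (1 + r) * (\<Sum>i\<in>I. x i)) \<le> (\<Prod>i\<in>I. u i (x i))" .
  have "w i (x i) * (\<Prod>j\<in>I - {i}. u j (x j)) = lam * x i * (\<Prod>i\<in>I. u i (x i))" if "i \<in> I" for i
    using * that assms(2) by (simp add: prod.remove[of I i])
  then show "(\<Sum>i\<in>I. w i (x i) * (\<Prod>j\<in>I - {i}. u j (x j)))
           = lam * (\<Sum>i\<in>I. x i) * (\<Prod>i\<in>I. u i (x i))"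
    by (simp add: sum_distrib_left sum_distrib_right)
qed

text \<open>At most one summand exceeds \<open>1/2\<close>. The product of the \<open>u\<close> over the others is
  at least \<open>e\<^bsup>-(1 + r) s\<^esup>\<close>, where \<open>s\<close> is their sum, so the claim says that \<open>e\<^bsup>(1 + r) s\<^esup>\<close> is at
  most an affine function of \<open>s\<close>; by convexity only the extreme values of \<open>s\<close> matter.
  Those are the values built into \<open>weight_pair\<close>.\<close>

lemma weight_certificate:
  assumes W: "\<And>i. i \<in> I \<Longrightarrow> weight_pair (u i) (w i)" and fin: "finite I"
    and x: "\<And>i. i \<in> I \<Longrightarrow> 0 \<le> x i" and sum: "(\<Sum>i\<in>I. x i) \<le> 1"
  shows "1 \<le> (\<Prod>i\<in>I. u i (x i)) + (\<Sum>i\<in>I. w i (x i) * (\<Prod>j\<in>I - {i}. u j (x j)))"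
proof (cases "\<exists>k\<in>I. x k > 1 / 2")
  case False
  define s where "s = (\<Sum>i\<in>I. x i)"
  have s: "0 \<le> s" "s \<le> 1" using sum x by (auto simp: s_def intro: sum_nonneg)
  have x': "0 \<le> x i \<and> x i \<le> 1 / 2" if "i \<in> I" for i
    using False x that by force
  note small = small_weights[of I u w x, OF W fin x', folded s_def]
  have "exp ((1 + r) * s) \<le> 1 + lam * s"
    by (rule exp_le_affine[OF s]) (use one_plus_lam in auto)
  then have "1 \<le> exp (- (1 + r) * s) * (1 + lam * s)"
    by (rule one_le_exp_minus_mult)
  also have "\<dots> \<le> (\<Prod>i\<in>I. u i (x i)) * (1 + lam * s)"
    using s lam_pos by (intro mult_right_mono small) auto
  also have "\<dots> = (\<Prod>i\<in>I. u i (x i)) + (\<Sum>i\<in>I. w i (x i) * (\<Prod>j\<in>I - {i}. u j (x j)))"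
    by (subst small) (auto simp: algebra_simps)
  finally show ?thesis .
next
  case True
  then obtain k where k: "k \<in> I" "x k > 1 / 2" by blast
  define J s where "J = I - {k}" and "s = (\<Sum>i\<in>J. x i)"
  have IJ: "I = insert k J" "k \<notin> J" "finite J" using k fin by (auto simp: J_def)
  have s: "0 \<le> s" "s \<le> 1 - x k" using sum x IJ by (auto simp: s_def intro!: sum_nonneg)
  have xJ: "0 \<le> x i \<and> x i \<le> 1 / 2" if "i \<in> J" for i
  proof -
    have "x i \<le> s" unfolding s_def using that IJ x by (intro member_le_sum) auto
    then show ?thesis using s k x that IJ by auto
  qed
  have WJ: "weight_pair (u i) (w i)" if "i \<in> J" for i using W that IJ by auto
  note small = small_weights[of J u w x, OF WJ IJ(3) xJ, folded s_def]
  define R where "R = (\<Prod>j\<in>J. u j (x j))"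
  have xk: "x k \<in> {1/2<..1}" using k s by auto
  have big: "1 \<le> u k (x k) + w k (x k)"
    "exp ((1 + r) * (1 - x k)) \<le> u k (x k) * (1 + lam * (1 - x k)) + w k (x k)"
    "0 \<le> u k (x k)" "0 \<le> w k (x k)"
    using W[OF k(1)] xk by (auto simp: weight_pair_def)
  have "exp ((1 + r) * s) \<le> (u k (x k) + w k (x k)) + u k (x k) * lam * s"
    by (rule exp_le_affine[OF s]) (use big in \<open>simp_all add: algebra_simps\<close>)
  then have "1 \<le> exp (- (1 + r) * s) * (u k (x k) + w k (x k) + u k (x k) * lam * s)"
    by (rule one_le_exp_minus_mult)
  also have "\<dots> \<le> R * (u k (x k) + w k (x k) + u k (x k) * lam * s)"
    unfolding R_def using s lam_pos big by (intro mult_right_mono small) auto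
  also have "\<dots> = u k (x k) * R + w k (x k) * R + u k (x k) * (lam * s * R)"
    by (simp add: algebra_simps)
  also have "lam * s * R = (\<Sum>i\<in>J. w i (x i) * (\<Prod>j\<in>J - {i}. u j (x j)))"
    unfolding R_def by (rule small(2)[symmetric])
  also have "u k (x k) * \<dots> = (\<Sum>i\<in>J. w i (x i) * (\<Prod>j\<in>I - {i}. u j (x j)))"
  proof -
    have "I - {i} = insert k (J - {i})" if "i \<in> J" for i using that IJ by auto
    then have "(\<Prod>j\<in>I - {i}. u j (x j)) = u k (x k) * (\<Prod>j\<in>J - {i}. u j (x j))" if "i \<in> J" for i
      using that IJ by simp
    then show ?thesis by (auto simp: sum_distrib_left intro!: sum.cong)
  qed
  also have "w k (x k) * R = w k (x k) * (\<Prod>j\<in>I - {k}. u j (x j))"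
    by (simp add: R_def J_def)
  also have "u k (x k) * R = (\<Prod>i\<in>I. u i (x i))"
    using IJ by (simp add: R_def)
  finally show ?thesis using IJ by (simp add: add.assoc)
qed

section \<open>From weights to the probability bound\<close>

lemma weight_pair_measurable:
  assumes "weight_pair u w"
  shows "u \<in> borel_measurable borel" "w \<in> borel_measurable borel"
  using assms by (auto simp: weight_pair_def)

lemma (in prob_space) integrable_weight:
  assumes "weight_pair u w" "random_variable borel X" "AE \<omega> in M. X \<omega> \<in> {0..1}"
  shows "integrable M (\<lambda>\<omega>. u (X \<omega>))" "integrable M (\<lambda>\<omega>. w (X \<omega>))"
proof -
  note [measurable] = weight_pair_measurable[OF assms(1)] assms(2)
  show "integrable M (\<lambda>\<omega>. u (X \<omega>))"
    using assms(3) by (intro integrable_const_bound[of _ 1])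
      (measurable, use assms(1) in \<open>auto simp: weight_pair_def\<close>)
  show "integrable M (\<lambda>\<omega>. w (X \<omega>))"
    using assms(3) by (intro integrable_const_bound[of _ "1 + lam"])
      (measurable, use assms(1) in \<open>auto simp: weight_pair_def\<close>)
qed

text \<open>The certificate is a sum of products of functions of single variables, so
  independence evaluates its expectation.\<close>

lemma (in prob_space) prob_le_weights:
  fixes I :: "'i set"
  assumes fin: "finite I" and ind: "indep_vars (\<lambda>_. borel) X I"
    and X: "\<And>i. i \<in> I \<Longrightarrow> AE \<omega> in M. X i \<omega> \<in> {0..1}"
    and W: "\<And>i. i \<in> I \<Longrightarrow> weight_pair (u i) (w i)"
  shows "prob {\<omega> \<in> space M. (\<Sum>i\<in>I. X i \<omega>) \<le> 1}
           \<le> (\<Prod>i\<in>I. expectation (\<lambda>\<omega>. u i (X i \<omega>)))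
             + (\<Sum>i\<in>I. expectation (\<lambda>\<omega>. w i (X i \<omega>)) *
                  (\<Prod>j\<in>I - {i}. expectation (\<lambda>\<omega>. u j (X j \<omega>))))"
proof -
  have rv [measurable]: "random_variable borel (X i)" if "i \<in> I" for i
    using ind that by (auto simp: indep_vars_def)
  \<comment> \<open>The product belonging to the index \<open>i\<close> uses \<open>w\<close> at the position \<open>i\<close> and \<open>u\<close> elsewhere.\<close>
  define v where "v = (\<lambda>i j. if j = i then w j else u j)"
  have v: "integrable M (\<lambda>\<omega>. v i j (X j \<omega>))" "v i j \<in> borel_measurable borel"
    and u: "integrable M (\<lambda>\<omega>. u j (X j \<omega>))" "u j \<in> borel_measurable borel" if "j \<in> I" for i j
    using integrable_weight[OF W[OF that] rv[OF that] X[OF that]]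
      weight_pair_measurable[OF W[OF that]] by (auto simp: v_def)
  have Pu: "integrable M (\<lambda>\<omega>. \<Prod>j\<in>I. u j (X j \<omega>))"
    "expectation (\<lambda>\<omega>. \<Prod>j\<in>I. u j (X j \<omega>)) = (\<Prod>j\<in>I. expectation (\<lambda>\<omega>. u j (X j \<omega>)))"
    using fin u by (intro indep_vars_integrable indep_vars_lebesgue_integral
        indep_vars_compose2[OF ind]; simp)+
  have Pv: "integrable M (\<lambda>\<omega>. \<Prod>j\<in>I. v i j (X j \<omega>))"
    "expectation (\<lambda>\<omega>. \<Prod>j\<in>I. v i j (X j \<omega>)) = (\<Prod>j\<in>I. expectation (\<lambda>\<omega>. v i j (X j \<omega>)))" for i
    using fin v by (intro indep_vars_integrable indep_vars_lebesgue_integral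
        indep_vars_compose2[OF ind]; simp)+
  have split: "(\<Prod>j\<in>I. g (v i j) j) = g (w i) i * (\<Prod>j\<in>I - {i}. g (u j) j)"
    if "i \<in> I" for i and g :: "(real \<Rightarrow> real) \<Rightarrow> 'i \<Rightarrow> real"
    using that fin by (simp add: prod.remove[of I i] v_def)
  define f where "f = (\<lambda>\<omega>. (\<Prod>j\<in>I. u j (X j \<omega>)) + (\<Sum>i\<in>I. \<Prod>j\<in>I. v i j (X j \<omega>)))"
  have int: "integrable M f" unfolding f_def using Pu Pv by auto
  have "AE \<omega> in M. \<forall>i\<in>I. X i \<omega> \<in> {0..1}"
    using X fin by (intro AE_finite_allI) auto
  then have "AE \<omega> in M. indicator {\<omega> \<in> space M. (\<Sum>i\<in>I. X i \<omega>) \<le> 1} \<omega> \<le> f \<omega>"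
  proof (eventually_elim, goal_cases)
    case (1 \<omega>)
    have f: "f \<omega> = (\<Prod>j\<in>I. u j (X j \<omega>)) + (\<Sum>i\<in>I. w i (X i \<omega>) * (\<Prod>j\<in>I - {i}. u j (X j \<omega>)))"
      unfolding f_def using split[of _ "\<lambda>h j. h (X j \<omega>)"] by simp
    have "0 \<le> u i (X i \<omega>)" "0 \<le> w i (X i \<omega>)" if "i \<in> I" for i
      using 1 W that by (auto simp: weight_pair_def)
    then have "0 \<le> f \<omega>"
      unfolding f by (intro add_nonneg_nonneg prod_nonneg sum_nonneg mult_nonneg_nonneg) auto
    moreover have "1 \<le> f \<omega>" if "(\<Sum>i\<in>I. X i \<omega>) \<le> 1"
      unfolding f using W fin that 1 by (intro weight_certificate) auto
    ultimately show ?case by (auto simp: indicator_def)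
  qed
  then have "expectation (indicator {\<omega> \<in> space M. (\<Sum>i\<in>I. X i \<omega>) \<le> 1}) \<le> expectation f"
    using int by (intro integral_mono_AE) (auto simp: emeasure_eq_measure)
  also have "expectation f = (\<Prod>j\<in>I. expectation (\<lambda>\<omega>. u j (X j \<omega>)))
      + (\<Sum>i\<in>I. \<Prod>j\<in>I. expectation (\<lambda>\<omega>. v i j (X j \<omega>)))"
    unfolding f_def using Pu Pv by simp
  also have "(\<Sum>i\<in>I. \<Prod>j\<in>I. expectation (\<lambda>\<omega>. v i j (X j \<omega>))) =
      (\<Sum>i\<in>I. expectation (\<lambda>\<omega>. w i (X i \<omega>)) * (\<Prod>j\<in>I - {i}. expectation (\<lambda>\<omega>. u j (X j \<omega>))))"
    using split[of _ "\<lambda>h j. expectation (\<lambda>\<omega>. h (X j \<omega>))"] by simp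
  finally show ?thesis by simp
qed

text \<open>The tangent of the exponential at \<open>1 + y = 1 / (1 - r)\<close>, that is at \<open>y = lam\<close>. The
  equation \<open>e\<^bsup>-(1 + r)\<^esup> = 1 - r\<close> makes the constant exactly \<open>e\<close>.\<close>

lemma one_plus_le_exp_r: "1 + y \<le> exp (1 + (1 - r) * y)"
proof -
  have "(1 - r) * (1 + y) \<le> exp ((1 - r) * (1 + y) - 1)"
    using exp_ge_add_one_self[of "(1 - r) * (1 + y) - 1"] by simp
  also have "\<dots> = exp (- (1 + r)) * exp (1 + (1 - r) * y)"
    by (simp flip: exp_add add: algebra_simps)
  also have "\<dots> = (1 - r) * exp (1 + (1 - r) * y)"
    by (simp only: exp_r)
  finally show ?thesis using r_less by simp
qed

text \<open>This decouples the variables: after the tangent inequality the bound is a product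
  over \<open>i\<close>, and each factor is controlled by the mean of its own variable.\<close>

lemma (in prob_space) prob_sum_le_exp:
  assumes fin: "finite I" and ind: "indep_vars (\<lambda>_. borel) X I"
    and X: "\<And>i. i \<in> I \<Longrightarrow> AE \<omega> in M. X i \<omega> \<in> {0..1}"
    and W: "\<And>i. i \<in> I \<Longrightarrow> weight_pair (u i) (w i)"
    and A: "\<And>i. i \<in> I \<Longrightarrow> 0 < expectation (\<lambda>\<omega>. u i (X i \<omega>))"
    and B: "\<And>i. i \<in> I \<Longrightarrow> ln (expectation (\<lambda>\<omega>. u i (X i \<omega>)))
        + (1 - r) * expectation (\<lambda>\<omega>. w i (X i \<omega>)) / expectation (\<lambda>\<omega>. u i (X i \<omega>)) \<le> - r * m i"
  shows "prob {\<omega> \<in> space M. (\<Sum>i\<in>I. X i \<omega>) \<le> 1} \<le> exp (1 - r * (\<Sum>i\<in>I. m i))"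
proof -
  define a b where "a = (\<lambda>i. expectation (\<lambda>\<omega>. u i (X i \<omega>)))"
    and "b = (\<lambda>i. expectation (\<lambda>\<omega>. w i (X i \<omega>)))"
  have a: "0 < a i" and ab: "ln (a i) + (1 - r) * b i / a i \<le> - r * m i" if "i \<in> I" for i
    using A[OF that] B[OF that] by (auto simp: a_def b_def)
  have P: "0 < (\<Prod>i\<in>I. a i)" using a by (intro prod_pos) auto
  have "prob {\<omega> \<in> space M. (\<Sum>i\<in>I. X i \<omega>) \<le> 1}
      \<le> (\<Prod>i\<in>I. a i) + (\<Sum>i\<in>I. b i * (\<Prod>j\<in>I - {i}. a j))"
    unfolding a_def b_def by (rule prob_le_weights[OF fin ind X W])
  also have "(\<Sum>i\<in>I. b i * (\<Prod>j\<in>I - {i}. a j)) = (\<Sum>i\<in>I. b i / a i * (\<Prod>i\<in>I. a i))"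
    using fin a by (intro sum.cong refl) (simp add: prod.remove less_imp_neq[symmetric])
  also have "(\<Prod>i\<in>I. a i) + \<dots> = (\<Prod>i\<in>I. a i) * (1 + (\<Sum>i\<in>I. b i / a i))"
    by (simp add: sum_distrib_left sum_distrib_right algebra_simps)
  also have "\<dots> \<le> (\<Prod>i\<in>I. a i) * exp (1 + (1 - r) * (\<Sum>i\<in>I. b i / a i))"
    using P by (intro mult_left_mono one_plus_le_exp_r) auto
  also have "(\<Prod>i\<in>I. a i) = (\<Prod>i\<in>I. exp (ln (a i)))" using a by simp
  also have "\<dots> = exp (\<Sum>i\<in>I. ln (a i))" using fin by (simp add: exp_sum)
  also have "exp (\<Sum>i\<in>I. ln (a i)) * exp (1 + (1 - r) * (\<Sum>i\<in>I. b i / a i))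
      = exp (1 + (\<Sum>i\<in>I. ln (a i) + (1 - r) * b i / a i))"
    by (simp flip: exp_add add: sum.distrib sum_distrib_left algebra_simps)
  also have "\<dots> \<le> exp (1 + (\<Sum>i\<in>I. - r * m i))"
    using ab by (simp add: sum_mono)
  finally show ?thesis by (simp add: sum_distrib_left sum_negf)
qed

section \<open>Weights for small means\<close>

lemma exp_ge_cubic: "1 + z + z^2 / 2 + z^3 / 6 \<le> exp z" if "0 \<le> z" for z :: real
proof -
  obtain t where "exp z = (\<Sum>k<4. z ^ k / fact k) + exp t / fact 4 * z ^ 4"
    using Maclaurin_exp_le by blast
  moreover have "0 \<le> exp t / fact 4 * z ^ 4" using that by simp
  ultimately show ?thesis by (simp add: eval_nat_numeral)
qed

lemma exp_le_cubic: "exp z \<le> 1 + z + z^2 / 2 + z^3 / 4" if "0 \<le> z" "z \<le> 1" for z :: real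
proof -
  obtain t where t: "\<bar>t\<bar> \<le> \<bar>z\<bar>" "exp z = (\<Sum>k<5. z ^ k / fact k) + exp t / fact 5 * z ^ 5"
    using Maclaurin_exp_le by blast
  have "exp t \<le> exp 1" using t(1) that by simp
  then have "exp t \<le> 3" using exp_le by linarith
  then have "exp t / fact 5 * z ^ 5 \<le> 3 / fact 5 * z ^ 5"
    using that by (intro mult_right_mono divide_right_mono) auto
  also have "\<dots> = z ^ 5 / 40" by (simp add: fact_numeral)
  finally have "exp t / fact 5 * z ^ 5 \<le> z ^ 5 / 40" .
  moreover have "z ^ 4 \<le> z ^ 3" "z ^ 5 \<le> z ^ 3"
    using that by (intro power_decreasing; simp)+
  moreover have "(\<Sum>k<5. z ^ k / fact k) = 1 + z + z^2 / 2 + z^3 / 6 + z^4 / 24"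
    by (simp add: lessThan_nat_numeral fact_numeral)
  moreover have "0 \<le> z ^ 3" using that by simp
  ultimately show ?thesis using t(2) by linarith
qed

text \<open>For a variable that jumps to \<open>x\<close> with small probability, the requirement
  \<open>ln A + (1 - r) B / A \<le> - r E X\<close> reads \<open>u x + (1 - r) w x \<le> 1 - r x\<close> to first order.
  Equality determines \<open>w_small\<close> from \<open>u_small\<close>. Below \<open>1/2\<close>, equality together with
  \<open>w = lam * x * u\<close> leaves only \<open>u = (1 - r x) / (1 + r x)\<close>. Above \<open>1/2\<close> a quadratic with
  a zero at 1 is chosen between two curves: \<open>weight_pair\<close> bounds it from above and
  \<open>u_small_ge_tangent\<close> from below.\<close>

definition u_small :: "real \<Rightarrow> real" where
  "u_small x = (if x \<le> 1/2 then (1 - r * x) / (1 + r * x) else (1 - x) * (1 - 2 * x / 5))"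

definition w_small :: "real \<Rightarrow> real" where
  "w_small x = (1 - r * x - u_small x) / (1 - r)"

text \<open>The remaining polynomial inequalities have slack, so these decimal bounds decide them.\<close>

lemma r_power_bounds:
  "0.70796 < r^2" "r^2 < 0.707965"
  "3.39077 < (1 + r)^2" "(1 + r)^2 < 3.39078" "6.2437 < (1 + r)^3" "(1 + r)^3 < 6.2438"
proof -
  have "0.841405^2 < r^2" "r^2 < 0.841406^2" "1.841405^2 < (1 + r)^2" "(1 + r)^2 < 1.841406^2"
    "1.841405^3 < (1 + r)^3" "(1 + r)^3 < 1.841406^3"
    using r_gt r_less by (intro power_strict_mono; simp)+
  then show "0.70796 < r^2" "r^2 < 0.707965"
  "3.39077 < (1 + r)^2" "(1 + r)^2 < 3.39078" "6.2437 < (1 + r)^3" "(1 + r)^3 < 6.2438"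
    by (simp_all add: eval_nat_numeral)
qed

text \<open>Equality holds at 0, so the exponential is expanded there; the cubic Taylor polynomial is
  accurate enough up to \<open>1/2\<close>, beyond which the inequality soon fails.\<close>

lemma exp_le_small_ratio:
  assumes "0 \<le> x" "x \<le> 1/2"
  shows "exp (- (1 + r) * x) \<le> (1 - r * x) / (1 + r * x)"
proof -
  have rx: "0 \<le> r * x" "r * x \<le> 0.841406 * x" "r * x \<le> 1 / 2"
    using assms r_gt r_less mult_mono[of r 1 x "1/2"] mult_right_mono[of r "0.841406" x] by auto
  have "x^2 \<le> x * (1/2)" "x^3 \<le> x * (1/4)"
    using assms mult_left_mono[of x "1/2" x] power_mono[of x "1/2" 2] mult_left_mono[of "x^2" "1/4" x]
    by (simp_all add: power2_eq_square power3_eq_cube)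
  then have "0 \<le> x * (158 + 145 * x - 386 * x^2 - 876 * x^3)"
    using assms by (intro mult_nonneg_nonneg) linarith+
  also have "\<dots> \<le> 1000 * ((1 - 0.841406 * x) * (1 + 1.841405 * x + 1.695385 * x^2 + 1.0406 * x^3)
      - (1 + 0.841406 * x))"
  proof -
    have "0 \<le> 0.593 * x + 1.01578457 * x^2 + 0.09288869 * x^3 + 0.4329164 * x^4"
      using assms by (intro add_nonneg_nonneg) auto
    then have "x * (158 + 145 * x - 386 * x^2 - 876 * x^3)
        \<le> x * (158 + 145 * x - 386 * x^2 - 876 * x^3)
          + (0.593 * x + 1.01578457 * x^2 + 0.09288869 * x^3 + 0.4329164 * x^4)"
      by simp
    also have "\<dots> = 1000 * ((1 - 0.841406 * x)
          * (1 + 1.841405 * x + 1.695385 * x^2 + 1.0406 * x^3) - (1 + 0.841406 * x))"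
      by (simp add: field_simps eval_nat_numeral)
    finally show ?thesis .
  qed
  finally have "1 + 0.841406 * x
      \<le> (1 - 0.841406 * x) * (1 + 1.841405 * x + 1.695385 * x^2 + 1.0406 * x^3)"
    by simp
  then have "1 + r * x
      \<le> (1 - 0.841406 * x) * (1 + 1.841405 * x + 1.695385 * x^2 + 1.0406 * x^3)"
    by (rule order_trans[OF add_left_mono[OF rx(2)]])
  also have "\<dots> \<le> (1 - r * x) * (1 + 1.841405 * x + 1.695385 * x^2 + 1.0406 * x^3)"
    using rx assms by (intro mult_right_mono) auto
  also have "\<dots> \<le> (1 - r * x) * exp ((1 + r) * x)"
  proof (rule mult_left_mono)
    have "1.841405 * x \<le> (1 + r) * x" "3.39077 * x^2 \<le> (1 + r)^2 * x^2"
      "6.2436 * x^3 \<le> (1 + r)^3 * x^3"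
      using assms r_gt r_power_bounds by (intro mult_right_mono; simp)+
    then have "1 + 1.841405 * x + 1.695385 * x^2 + 1.0406 * x^3
        \<le> 1 + (1 + r) * x + ((1 + r) * x)^2 / 2 + ((1 + r) * x)^3 / 6"
      unfolding power_mult_distrib by simp
    also have "\<dots> \<le> exp ((1 + r) * x)"
      using assms r_gt by (intro exp_ge_cubic) auto
    finally show "1 + 1.841405 * x + 1.695385 * x^2 + 1.0406 * x^3 \<le> exp ((1 + r) * x)" .
  qed (use rx in auto)
  finally have "exp (- (1 + r) * x) * (1 + r * x)
      \<le> exp (- (1 + r) * x) * ((1 - r * x) * exp ((1 + r) * x))"
    by (intro mult_left_mono) auto
  also have "\<dots> = (1 - r * x) * (exp (- (1 + r) * x) * exp ((1 + r) * x))"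
    by (simp only: mult_ac)
  also have "exp (- (1 + r) * x) * exp ((1 + r) * x) = 1"
    unfolding exp_add[symmetric] by (simp add: algebra_simps)
  finally show ?thesis using rx by (simp add: pos_le_divide_eq)
qed

lemma weight_pair_small: "weight_pair u_small w_small"
proof -
  have r: "0 < r" "r < 1" using r_gt r_less by auto
  have rx: "0 \<le> r * x" "r * x \<le> r" if "x \<in> {0..1}" for x
    using that r mult_left_mono[of x 1 r] by auto
  have u: "0 \<le> u_small x" "u_small x \<le> 1 - r * x" if "x \<in> {0..1}" for x
  proof -
    have "0 \<le> 1 - r * x" "0 \<le> 1 + r * x" using rx[OF that] r by linarith+
    then show "0 \<le> u_small x" using that by (auto simp: u_small_def)
    show "u_small x \<le> 1 - r * x"
    proof (cases "x \<le> 1/2")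
      case True
      have pos: "0 \<le> 1 - r * x" "0 < 1 + r * x" "1 \<le> 1 + r * x"
        using rx[OF that] r by linarith+
      then have "(1 - r * x) / (1 + r * x) \<le> (1 - r * x) / 1"
        by (intro divide_left_mono) simp_all
      then show ?thesis using True by (simp add: u_small_def)
    next
      case False
      have "(1 - x) * (1 - 2 * x / 5) \<le> (1 - x) * (0.8)"
        using that False by (intro mult_left_mono) auto
      also have "\<dots> \<le> 1 - r * x" 
        using that r_less mult_right_mono[of r "0.85" x] by simp
      finally show ?thesis using False by (simp add: u_small_def)
    qed
  qed
  have w: "0 \<le> w_small x" "w_small x \<le> 1 + lam" if "x \<in> {0..1}" for x
  proof -
    show "0 \<le> w_small x" using u[OF that] r by (simp add: w_small_def)
    have "w_small x \<le> 1 / (1 - r)"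
      unfolding w_small_def using u(1)[OF that] rx[OF that] r by (intro divide_right_mono) linarith+
    also have "\<dots> = 1 + lam" using r by (simp add: lam_def field_simps)
    finally show "w_small x \<le> 1 + lam" .
  qed
  have low: "exp (- (1 + r) * x) \<le> u_small x \<and> w_small x = lam * x * u_small x"
    if "x \<in> {0..1/2}" for x
  proof -
    have x: "0 \<le> x" "x \<le> 1/2" "1 + r * x > 0" using that r by (auto intro: add_pos_nonneg)
    have "1 - r * x - (1 - r * x) / (1 + r * x) = r * x * ((1 - r * x) / (1 + r * x))"
      using x(3) by (simp add: field_simps)
    then show ?thesis using x exp_le_small_ratio[OF x(1,2)]
      by (simp add: u_small_def w_small_def lam_def)
  qed
  \<comment> \<open>Above \<open>1/2\<close>, everything is expressed in the distance \<open>d = 1 - x\<close> and multiplied by \<open>1 - r\<close>.\<close>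
  have high: "1 \<le> u_small x + w_small x \<and>
     exp ((1 + r) * (1 - x)) \<le> u_small x * (1 + lam * (1 - x)) + w_small x"
    if "x \<in> {1/2<..1}" for x
  proof
    define d where "d = 1 - x"
    have d: "0 \<le> d" "d < 1/2" using that by (auto simp: d_def)
    define v where "v = u_small x"
    have v: "v = d * (3 + 2 * d) / 5"
      using that by (simp add: v_def u_small_def d_def field_simps)
    have w: "(1 - r) * w_small x = 1 - r + r * d - v"
    proof -
      have "(1 - r) * w_small x = 1 - r * x - v" using r by (simp add: w_small_def v_def)
      then show ?thesis by (simp add: d_def algebra_simps)
    qed
    have "d * (3 + 2 * d) / 5 \<le> d * 1"
      using d mult_left_mono[of "3 + 2 * d" 5 d] by simp
    then have "v \<le> d" by (simp add: v)
    then have "r * v \<le> r * d" using r by (intro mult_left_mono) auto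
    then have "(1 - r) * 1 \<le> (1 - r) * (v + w_small x)"
      by (simp only: distrib_left w) (simp add: algebra_simps)
    then show "1 \<le> u_small x + w_small x"
      using r by (simp only: mult_le_cancel_left_pos v_def)
    have L: "(1 + r) * d \<le> 1.841406 * d" "(1 + r)^2 * d^2 \<le> 3.39078 * d^2"
      "(1 + r)^3 * d^3 \<le> 6.2438 * d^3"
      using d r_less r_power_bounds by (intro mult_right_mono; simp)+
    have "(1 + r) * d \<le> 1" using L(1) d by simp
    then have "exp ((1 + r) * d) \<le> 1 + (1 + r) * d + ((1 + r) * d)^2 / 2 + ((1 + r) * d)^3 / 4"
      using d r by (intro exp_le_cubic) auto
    also have "\<dots> \<le> 1 + 1.841406 * d + 1.69539 * d^2 + 1.56095 * d^3"
      using L unfolding power_mult_distrib by simp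
    finally have "(1 - r) * exp ((1 + r) * d)
        \<le> (1 - r) * (1 + 1.841406 * d + 1.69539 * d^2 + 1.56095 * d^3)"
      using r by (intro mult_left_mono) auto
    also have "\<dots> = 1 - r + (1 - r) * (1.841406 * d + 1.69539 * d^2 + 1.56095 * d^3)"
      by (simp add: algebra_simps)
    also have "\<dots> \<le> 1 - r + 0.158595 * (1.841406 * d + 1.69539 * d^2 + 1.56095 * d^3)"
      using r_gt d by (intro add_left_mono mult_right_mono) auto
    also have "\<dots> \<le> 1 - r + 0.841405 * (d * (2 + d + 2 * d^2) / 5)"
    proof -
      \<comment> \<open>The multiple of \<open>d * (d - 0.55)^2\<close> contained in the difference absorbs its negative quadratic term.\<close>
      define d2 d3 e where "d2 = d^2" and "d3 = d^3" and "e = d * (d - 0.55)^2"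
      have nonneg: "0 \<le> d2" "0 \<le> d3" "0 \<le> e" using d by (simp_all add: d2_def d3_def e_def)
      have d2: "d2 \<le> d * (1/2)"
        unfolding d2_def power2_eq_square using d by (intro mult_left_mono) auto
      have e: "e = d3 - 1.1 * d2 + 0.3025 * d"
        by (simp add: e_def d2_def d3_def eval_nat_numeral algebra_simps)
      have "0.158595 * (1.841406 * d + 1.69539 * d2 + 1.56095 * d3)
          \<le> 0.841405 * (0.4 * d + 0.2 * d2 + 0.4 * d3)"
        using nonneg d e d2 by (simp add: field_simps)
      also have "0.4 * d + 0.2 * d2 + 0.4 * d3 = d * (2 + d + 2 * d^2) / 5"
        by (simp add: d2_def d3_def eval_nat_numeral algebra_simps)
      finally show ?thesis by (simp add: d2_def d3_def)
    qed
    also have "\<dots> \<le> 1 - r + r * (d * (2 + d + 2 * d^2) / 5)"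
      using d r_gt by (intro add_left_mono mult_right_mono) auto
    also have "\<dots> = v * ((1 - r) + r * d) + (1 - r + r * d - v)"
      by (simp add: v field_simps eval_nat_numeral)
    also have "\<dots> = (1 - r) * (v * (1 + lam * d) + w_small x)"
    proof -
      have "(1 - r) * (1 + lam * d) = (1 - r) + r * d"
        using r by (simp add: lam_def distrib_left)
      then have "(1 - r) * (v * (1 + lam * d)) = v * ((1 - r) + r * d)"
        by (metis mult.left_commute)
      then show ?thesis by (simp only: distrib_left[of "1 - r" "v * (1 + lam * d)"] w)
    qed
    finally show "exp ((1 + r) * (1 - x)) \<le> u_small x * (1 + lam * (1 - x)) + w_small x"
      using r by (simp only: mult_le_cancel_left_pos v_def d_def)
  qed
  have "u_small \<in> borel_measurable borel" "w_small \<in> borel_measurable borel"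
    unfolding u_small_def w_small_def by measurable
  moreover have "u_small x \<le> 1" if "x \<in> {0..1}" for x
    using u(2)[OF that] rx(1)[OF that] by linarith
  ultimately show ?thesis
    unfolding weight_pair_def using u w low high by blast
qed

section \<open>Laws with mean at most 1/2\<close>

text \<open>The left side is the tangent at \<open>s\<close> of the convex function \<open>(1 - t) e\<^bsup>-t\<^esup>\<close>; multiplying
  \<open>1 + (s - t) \<le> e\<^bsup>s - t\<^esup>\<close> by \<open>1 - t\<close> gives the tangent plus the square \<open>(t - s)\<^sup>2\<close> as a lower
  bound.\<close>

lemma tangent_le:
  fixes s t :: real
  assumes "t \<le> 1"
  shows "exp (- s) * ((1 - s) - (2 - s) * (t - s)) \<le> (1 - t) * exp (- t)"
proof -
  have "(1 - s) - (2 - s) * (t - s) \<le> (1 - t) * (1 + (s - t))"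
    using zero_le_power2[of "t - s"] by (simp add: power2_eq_square algebra_simps)
  also have "\<dots> \<le> (1 - t) * exp (s - t)"
    using assms by (intro mult_left_mono exp_ge_add_one_self) auto
  finally have "exp (- s) * ((1 - s) - (2 - s) * (t - s)) \<le> exp (- s) * ((1 - t) * exp (s - t))"
    by (intro mult_left_mono) auto
  also have "\<dots> = (1 - t) * (exp (- s) * exp (s - t))" by simp
  also have "exp (- s) * exp (s - t) = exp (- t)" by (simp flip: exp_add)
  finally show ?thesis .
qed

text \<open>By convexity, to the right of \<open>t\<close> the tangent at \<open>t\<close> lies above all tangents at
  earlier points.\<close>

lemma tangent_le_right:
  fixes s t x :: real
  assumes "s \<le> t" "t \<le> 1" "t \<le> x"
  shows "exp (- s) * ((1 - s) - (2 - s) * (x - s)) \<le> exp (- t) * ((1 - t) - (2 - t) * (x - t))"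
proof -
  have "exp (- s) * ((1 - s) - (2 - s) * (x - s))
      = exp (- s) * ((1 - s) - (2 - s) * (t - s)) - exp (- s) * (2 - s) * (x - t)"
    by (simp add: algebra_simps)
  also have "\<dots> \<le> (1 - t) * exp (- t) - exp (- t) * (2 - t) * (x - t)"
    using assms by (intro diff_mono tangent_le mult_right_mono mult_mono) auto
  finally show ?thesis by (simp add: algebra_simps)
qed

text \<open>Jensen's inequality for \<open>(1 - r x) e\<^bsup>-r x\<^esup>\<close> would need \<open>u_small\<close> to dominate this function
  on all of \<open>[0, 1]\<close>, which fails at 1. Only its tangents at the points \<open>m \<le> 1/2\<close> are needed,
  and to the right of \<open>1/2\<close> all of them lie below the tangent at \<open>1/2\<close>.\<close>

lemma u_small_ge_tangent:
  assumes "m \<le> 1/2" "x \<in> {0..1}"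
  shows "exp (- (r * m)) * ((1 - r * m) - (2 - r * m) * (r * x - r * m)) \<le> u_small x"
proof -
  have rx: "0 \<le> r * x" "r * x \<le> r" "r * m \<le> r * (1/2)"
    using assms r_gt mult_left_mono[of x 1 r] mult_left_mono[of m "1/2" r] by auto
  show ?thesis
  proof (cases "x \<le> 1/2")
    case True
    have "exp (- (r * m)) * ((1 - r * m) - (2 - r * m) * (r * x - r * m))
        \<le> (1 - r * x) * exp (- (r * x))"
      using rx r_less by (intro tangent_le) auto
    also have "\<dots> \<le> (1 - r * x) * (1 / (1 + r * x))"
    proof (rule mult_left_mono)
      have "1 + r * x \<le> exp (r * x)" by (rule exp_ge_add_one_self)
      then show "exp (- (r * x)) \<le> 1 / (1 + r * x)"
        using rx by (simp add: exp_minus inverse_eq_divide frac_le)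
    qed (use rx r_less in auto)
    finally show ?thesis using True by (simp add: u_small_def)
  next
    case False
    define d where "d = 1 - x"
    have d: "0 \<le> d" "d < 1/2" using False assms by (auto simp: d_def)
    have "exp (- (r * m)) * ((1 - r * m) - (2 - r * m) * (r * x - r * m))
        \<le> exp (- (r * (1/2))) * ((1 - r * (1/2)) - (2 - r * (1/2)) * (r * x - r * (1/2)))"
      using rx r_gt r_less False assms by (intro tangent_le_right) auto
    also have "\<dots> \<le> exp (- (r * (1/2))) * (- 0.0851 + 1.32893 * d)"
    proof (intro mult_left_mono)
      have "(1 - r * (1/2)) - (2 - r * (1/2)) * (r * x - r * (1/2))
          = 1 - 3/2 * r + r^2 / 4 + (2 * r - r^2 / 2) * d"
        by (simp add: d_def field_simps power2_eq_square)
      also have "\<dots> \<le> - 0.0851 + 1.32893 * d"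
        using r_gt r_less r_power_bounds d by (intro add_mono mult_right_mono) auto
      finally show "(1 - r * (1/2)) - (2 - r * (1/2)) * (r * x - r * (1/2))
          \<le> - 0.0851 + 1.32893 * d" .
    qed auto
    also have "\<dots> \<le> d * (3 + 2 * d) / 5"
    proof (cases "- 0.0851 + 1.32893 * d \<le> 0")
      case True
      then have "exp (- (r * (1/2))) * (- 0.0851 + 1.32893 * d) \<le> 0"
        by (intro mult_nonneg_nonpos) auto
      also have "0 \<le> d * (3 + 2 * d) / 5" using d by auto
      finally show ?thesis .
    next
      case False
      have "1 / 0.658 \<le> 1 + 0.42 + 0.42^2 / 2 + 0.42^3 / (6::real)" by (simp add: eval_nat_numeral)
      also have "\<dots> \<le> exp 0.42" by (rule exp_ge_cubic) simp
      also have "\<dots> \<le> exp (r * (1/2))" using r_gt by simp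
      finally have "exp (- (r * (1/2))) \<le> 0.658"
        by (simp add: exp_minus field_simps)
      then have "exp (- (r * (1/2))) * (- 0.0851 + 1.32893 * d)
          \<le> 0.658 * (- 0.0851 + 1.32893 * d)"
        using False by (intro mult_right_mono) auto
      also have "\<dots> \<le> d * (3 + 2 * d) / 5"
      proof -
        \<comment> \<open>0.343 is near the minimum of the difference of the two sides.\<close>
        have "0 \<le> 0.4 * (d - 0.343)^2" by simp
        then show ?thesis using d by (simp add: power2_eq_square algebra_simps)
      qed
      finally show ?thesis .
    qed
    also have "\<dots> = u_small x" using False by (simp add: u_small_def d_def field_simps)
    finally show ?thesis .
  qed
qed

text \<open>Both sides are 1 at 0, and the derivative of the left side is \<open>e\<^sup>s \<le> 1 / (1 - s)\<close>, the derivative of the right side.\<close>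

lemma exp_le_one_minus_ln:
  fixes s :: real
  assumes "0 \<le> s" "s < 1"
  shows "exp s \<le> 1 - ln (1 - s)"
proof -
  define f :: "real \<Rightarrow> real" where "f = (\<lambda>x. 1 - ln (1 - x) - exp x)"
  have "f 0 \<le> f s"
  proof (rule DERIV_nonneg_imp_nondecreasing[where f = f])
    fix x assume x: "0 \<le> x" "x \<le> s"
    have "1 - x \<le> exp (- x)" using exp_ge_add_one_self[of "- x"] by simp
    then have "(1 - x) * exp x \<le> exp (- x) * exp x" by (intro mult_right_mono) auto
    then have "exp x \<le> 1 / (1 - x)" using x assms by (simp add: field_simps flip: exp_add)
    moreover have "(f has_real_derivative 1 / (1 - x) - exp x) (at x)"
      unfolding f_def using x assms by (auto intro!: derivative_eq_intros)
    ultimately show "\<exists>y. (f has_real_derivative y) (at x) \<and> 0 \<le> y"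
      by (intro exI[of _ "1 / (1 - x) - exp x"]) auto
  qed (rule assms)
  then show ?thesis by (simp add: f_def)
qed

text \<open>As a function of \<open>A\<close> the left side decreases up to \<open>A = 1 - s\<close>, so the least admissible
  \<open>A\<close> is the worst; at \<open>A = (1 - s) e\<^bsup>-s\<^esup>\<close> the claim is \<open>exp_le_one_minus_ln\<close>.\<close>

lemma ln_plus_ratio_le:
  fixes s A :: real
  assumes "0 \<le> s" "s < 1" "(1 - s) * exp (- s) \<le> A" "A \<le> 1 - s"
  shows "ln A + (1 - s) / A \<le> 1 - s"
proof -
  have "0 < (1 - s) * exp (- s)" using assms by simp
  then have A: "0 < A" using assms by linarith
  define y where "y = (1 - s) / A"
  have y: "1 \<le> y" using assms A by (simp add: y_def)
  have "(1 - s) * exp (- s) * exp s \<le> A * exp s" using assms by (intro mult_right_mono) auto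
  then have ye: "y \<le> exp s" using A by (simp add: y_def field_simps flip: exp_add)
  have "s - ln y = ln (exp s / y)" using y by (simp add: ln_div)
  also have "\<dots> \<le> exp s / y - 1" using y by (intro ln_le_minus_one) auto
  also have "\<dots> = (exp s - y) / y" using y by (simp add: field_simps)
  also have "\<dots> \<le> (exp s - y) / 1" using y ye by (intro divide_left_mono) auto
  finally have "y - ln y \<le> exp s - s" by simp
  moreover have "ln A = ln (1 - s) - ln y" using A assms by (simp add: y_def ln_div)
  ultimately show ?thesis using exp_le_one_minus_ln[OF assms(1,2)] by (simp add: y_def)
qed

text \<open>Equality in \<open>u + (1 - r) w = 1 - r x\<close> turns \<open>(1 - r) B\<close> into \<open>1 - r E X - A\<close>, which leaves
  a condition on \<open>A\<close> and the mean alone.\<close>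

lemma (in prob_space) small_mean_bound:
  assumes [measurable]: "random_variable borel X" and X: "AE \<omega> in M. X \<omega> \<in> {0..1}"
    and m: "expectation X \<le> 1/2"
  shows "0 < expectation (\<lambda>\<omega>. u_small (X \<omega>))"
    and "ln (expectation (\<lambda>\<omega>. u_small (X \<omega>)))
      + (1 - r) * expectation (\<lambda>\<omega>. w_small (X \<omega>)) / expectation (\<lambda>\<omega>. u_small (X \<omega>))
      \<le> - r * expectation X"
proof -
  define m A where "m = expectation X" and "A = expectation (\<lambda>\<omega>. u_small (X \<omega>))"
  note int = integrable_weight[OF weight_pair_small assms(1) X]
  have intX: "integrable M X"
    using X by (intro integrable_const_bound[of _ 1]) auto
  have "0 \<le> m" unfolding m_def using X by (intro integral_nonneg_AE) auto
  then have s: "0 \<le> r * m" "r * m < 1"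
    using m r_gt r_less mult_mono[of r 1 m "1/2"] by (auto simp: m_def)
  have B: "(1 - r) * expectation (\<lambda>\<omega>. w_small (X \<omega>)) = 1 - r * m - A"
    unfolding w_small_def using int(1) intX r_less prob_space by (simp add: m_def A_def)
  have "expectation (\<lambda>\<omega>. exp (- (r * m)) * ((1 - r * m) - (2 - r * m) * (r * X \<omega> - r * m))) \<le> A"
    unfolding A_def
    using X int(1) intX m by (intro integral_mono_AE) (auto intro!: u_small_ge_tangent simp: m_def)
  then have low: "(1 - r * m) * exp (- (r * m)) \<le> A"
    using intX prob_space by (simp add: m_def mult.commute)
  have "0 \<le> expectation (\<lambda>\<omega>. w_small (X \<omega>))"
    using X weight_pair_small by (intro integral_nonneg_AE) (auto simp: weight_pair_def)
  then have "0 \<le> 1 - r * m - A" unfolding B[symmetric] using r_less by simp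
  then have "ln A + (1 - r * m) / A \<le> 1 - r * m"
    using s low by (intro ln_plus_ratio_le) auto
  moreover have "0 < (1 - r * m) * exp (- (r * m))" using s by simp
  then have A: "0 < A" using low by linarith
  ultimately have "ln A + (1 - r * m - A) / A \<le> - r * m"
    by (simp add: diff_divide_distrib)
  with A show "0 < expectation (\<lambda>\<omega>. u_small (X \<omega>))"
    and "ln (expectation (\<lambda>\<omega>. u_small (X \<omega>)))
      + (1 - r) * expectation (\<lambda>\<omega>. w_small (X \<omega>)) / expectation (\<lambda>\<omega>. u_small (X \<omega>))
      \<le> - r * expectation X"
    unfolding B A_def m_def by simp_all
qed

section \<open>Weights for large means\<close>

definition u_large :: "real \<Rightarrow> real" where
  "u_large x = exp (- (1 + r) * x)"

definition w_large :: "real \<Rightarrow> real" where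
  "w_large x = lam * x * u_large x"

lemma u_large_le: "u_large x \<le> 1 - r * x" if "x \<in> {0..1}"
proof -
  have "exp (- (1 + r) * x) \<le> 1 + (- r) * x"
    by (rule exp_le_affine[of 0 _ 1]) (use that exp_r in auto)
  then show ?thesis by (simp add: u_large_def)
qed

text \<open>Above \<open>1/2\<close>, the first inequality is the chord of \<open>e\<^bsup>(1 + r) x\<^esup>\<close> over \<open>[0, 1]\<close>; the second one is an
  equality because \<open>1 + lam = e\<^bsup>1 + r\<^esup>\<close>.\<close>

lemma weight_pair_large: "weight_pair u_large w_large"
proof -
  have r: "0 < r" "r < 1" using r_gt r_less by auto
  have u: "0 \<le> u_large x" "u_large x \<le> 1" if "x \<in> {0..1}" for x
    using that r by (auto simp: u_large_def mult_nonpos_nonneg)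
  have w: "0 \<le> w_large x" "w_large x \<le> 1 + lam" if "x \<in> {0..1}" for x
  proof -
    show "0 \<le> w_large x" using u[OF that] that lam_pos by (auto simp: w_large_def)
    have "lam * x * u_large x \<le> lam * 1 * 1"
      using u[OF that] that lam_pos by (intro mult_mono) auto
    then show "w_large x \<le> 1 + lam" by (simp add: w_large_def)
  qed
  have high: "1 \<le> u_large x + w_large x \<and>
     exp ((1 + r) * (1 - x)) \<le> u_large x * (1 + lam * (1 - x)) + w_large x"
    if "x \<in> {1/2<..1}" for x
  proof
    have "exp ((1 + r) * x) \<le> 1 + lam * x"
      by (rule exp_le_affine[of 0 _ 1]) (use that one_plus_lam in auto)
    then have "1 \<le> exp (- (1 + r) * x) * (1 + lam * x)"
      by (rule one_le_exp_minus_mult)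
    then show "1 \<le> u_large x + w_large x"
      by (simp add: u_large_def w_large_def algebra_simps)
    have "exp ((1 + r) * (1 - x)) = u_large x * exp (1 + r)"
      by (simp add: u_large_def algebra_simps flip: exp_add)
    also have "\<dots> = u_large x * (1 + lam * (1 - x)) + w_large x"
      unfolding one_plus_lam[symmetric] by (simp add: w_large_def algebra_simps)
    finally show "exp ((1 + r) * (1 - x)) \<le> u_large x * (1 + lam * (1 - x)) + w_large x"
      by simp
  qed
  have "u_large \<in> borel_measurable borel" "w_large \<in> borel_measurable borel"
    unfolding u_large_def w_large_def by measurable
  then show ?thesis
    unfolding weight_pair_def using u w high by (auto simp: u_large_def w_large_def)
qed

text \<open>The right side is the tangent of the left side at 0 and also agrees with it at 1. Near 0
  the difference vanishes to second order, and a cubic Taylor polynomial of \<open>e\<^bsup>(1 + r) x\<^esup>\<close> suffices up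
  to \<open>0.78\<close>; near 1 it is expanded in \<open>1 - x\<close> with the exact value \<open>e\<^bsup>-(1 + r)\<^esup> = 1 - r\<close>.\<close>

lemma u_large_tangent:
  assumes "x \<in> {0..1}"
  shows "(r + x) * u_large x \<le> r - (r^2 + r - 1) * x"
proof -
  define b where "b = r^2 + r - 1"
  have b: "0.549365 < b" "b < 0.549371" using r_gt r_less r_power_bounds by (auto simp: b_def)
  have bx: "0 \<le> r - b * x"
  proof -
    have "b * x \<le> b * 1" using assms b by (intro mult_left_mono) auto
    then show ?thesis using b r_gt by linarith
  qed
  have "r + x \<le> exp ((1 + r) * x) * (r - b * x)"
  proof (cases "x \<le> 0.78")
    case True
    have x: "0 \<le> x" using assms by simp
    have p: "r^2 = b + 1 - r" by (simp add: b_def)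
    have "r + x + x^2 * (0.4147 - 0.0563 * x - 0.5718 * x^2)
       \<le> (r - b * x) * (1 + (1 + r) * x + ((1 + r) * x)^2 / 2 + ((1 + r) * x)^3 / 6)"
    proof -
      have "(r - b * x) * (1 + (1 + r) * x + ((1 + r) * x)^2 / 2 + ((1 + r) * x)^3 / 6)
        = r + (r * (1 + r) - b) * x + x^2 * ((r * (1 + r)^2 / 2 - b * (1 + r))
          - (b * (1 + r)^2 / 2 - r * (1 + r)^3 / 6) * x - b * (1 + r)^3 / 6 * x^2)"
        by (simp add: field_simps eval_nat_numeral)
      also have "r * (1 + r) - b = 1" by (simp add: b_def power2_eq_square algebra_simps)
      finally have eq: "(r - b * x) * (1 + (1 + r) * x + ((1 + r) * x)^2 / 2 + ((1 + r) * x)^3 / 6)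
        = r + x + x^2 * ((r * (1 + r)^2 / 2 - b * (1 + r))
          - (b * (1 + r)^2 / 2 - r * (1 + r)^3 / 6) * x - b * (1 + r)^3 / 6 * x^2)"
        by simp
      have "0.841405 * 3.39077 \<le> r * (1 + r)^2" "b * (1 + r) \<le> 0.549371 * 1.841406"
        "b * (1 + r)^2 \<le> 0.549371 * 3.39078" "0.841405 * 6.2437 \<le> r * (1 + r)^3"
        "b * (1 + r)^3 \<le> 0.549371 * 6.2438"
        using r_gt r_less r_power_bounds b by (intro mult_mono; simp)+
      then have "0.4147 \<le> r * (1 + r)^2 / 2 - b * (1 + r)"
        "b * (1 + r)^2 / 2 - r * (1 + r)^3 / 6 \<le> 0.0563" "b * (1 + r)^3 / 6 \<le> 0.5718"
        by simp_all
      then show ?thesis unfolding eq using x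
        by (intro add_left_mono mult_left_mono diff_mono mult_right_mono) auto
    qed
    moreover have "x^2 \<le> 0.78 * 0.78"
      using True x unfolding power2_eq_square by (intro mult_mono) auto
    then have "0 \<le> x^2 * (0.4147 - 0.0563 * x - 0.5718 * x^2)"
      using True by (intro mult_nonneg_nonneg) auto
    moreover have "(r - b * x) * (1 + (1 + r) * x + ((1 + r) * x)^2 / 2 + ((1 + r) * x)^3 / 6)
        \<le> (r - b * x) * exp ((1 + r) * x)"
      using x r_gt bx by (intro mult_left_mono exp_ge_cubic) auto
    ultimately show ?thesis by (simp add: mult.commute)
  next
    case False
    define d where "d = 1 - x"
    have d: "0 \<le> d" "d < 0.22" using False assms by (auto simp: d_def)
    define y where "y = (1 + r) * d"
    have y: "y \<le> 1.841406 * d" "y < 1"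
      using d r_less mult_right_mono[of "1 + r" "1.841406" d] by (auto simp: y_def)
    \<comment> \<open>\<open>(1 - y / 2)^2 \<le> e\<^bsup>-y\<^esup>\<close> keeps a second-order term and is still elementary.\<close>
    have "(1 - 0.920703 * d)^2 \<le> (1 - y / 2)^2"
      using y d by (intro power_mono) auto
    also have "\<dots> \<le> exp (- (y / 2))^2"
      using y exp_ge_add_one_self[of "- (y / 2)"] by (intro power_mono) auto
    also have "\<dots> = exp (- y)"
      by (simp add: power2_eq_square flip: exp_add)
    finally have e: "(1 - 0.920703 * d)^2 \<le> exp (- ((1 + r) * d))" by (simp add: y_def)
    have "(1 - r) * (r + x) = (1 - r^2) - (1 - r) * d"
      by (simp add: d_def algebra_simps power2_eq_square)
    also have "\<dots> \<le> (1 - r^2) - 0.158594 * d"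
      using d r_less by (intro diff_mono mult_right_mono) auto
    also have "\<dots> \<le> (1 - 0.920703 * d)^2 * (1 - r^2 + 0.549365 * d)"
    proof -
      have "(1 - 0.920703 * d)^2 * (1 - r^2 + 0.549365 * d) - ((1 - r^2) - 0.158594 * d)
        = d * (0.707959 - 1.841406 * (1 - r^2) - d * (1.841406 * 0.549365 - 0.920703^2 * (1 - r^2))
          + 0.920703^2 * 0.549365 * d^2)"
        by (simp add: power2_eq_square field_simps)
      also have "0 \<le> \<dots>"
      proof (intro mult_nonneg_nonneg d(1))
        define k t v where "k = r^2"
          and "t = d * (1.841406 * 0.549365 - 0.920703^2 * (1 - r^2))"
          and "v = 0.920703^2 * 0.549365 * d^2"
        have "t \<le> d * 0.765"
          unfolding t_def using d r_power_bounds(1,2)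
          by (intro mult_left_mono) (simp_all add: field_simps)
        moreover have "0 \<le> v" by (simp add: v_def)
        moreover have "0.70796 < k" using r_power_bounds by (simp add: k_def)
        ultimately have "0 \<le> 0.707959 - 1.841406 * (1 - k) - t + v"
          using d by (simp add: field_simps)
        then show "0 \<le> 0.707959 - 1.841406 * (1 - r^2)
            - d * (1.841406 * 0.549365 - 0.920703^2 * (1 - r^2)) + 0.920703^2 * 0.549365 * d^2"
          by (simp only: k_def t_def v_def)
      qed
      finally show ?thesis by simp
    qed
    also have "\<dots> \<le> exp (- ((1 + r) * d)) * (1 - r^2 + b * d)"
    proof (rule mult_mono[OF e])
      show "1 - r^2 + 0.549365 * d \<le> 1 - r^2 + b * d"
        using b d by (intro add_left_mono mult_right_mono) auto
    qed (use d r_power_bounds in auto)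
    also have "1 - r^2 + b * d = r - b * x"
      by (simp add: d_def b_def algebra_simps)
    also have "exp (- ((1 + r) * d)) = exp (- (1 + r)) * exp ((1 + r) * x)"
      by (simp add: d_def algebra_simps flip: exp_add)
    also have "exp (- (1 + r)) * exp ((1 + r) * x) * (r - b * x)
        = (1 - r) * (exp ((1 + r) * x) * (r - b * x))"
      by (simp only: exp_r mult.assoc)
    finally show ?thesis using r_less by simp
  qed
  then have "(r + x) * exp (- (1 + r) * x) \<le> exp ((1 + r) * x) * (r - b * x) * exp (- (1 + r) * x)"
    by (intro mult_right_mono) auto
  also have "\<dots> = (r - b * x) * (exp ((1 + r) * x) * exp (- (1 + r) * x))"
    by simp
  also have "exp ((1 + r) * x) * exp (- (1 + r) * x) = 1"
    unfolding exp_add[symmetric] by (simp add: algebra_simps)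
  finally show ?thesis by (simp add: u_large_def b_def)
qed

section \<open>Laws with mean at least 1/2\<close>

text \<open>Replacing \<open>e\<^bsup>-2s\<^esup>\<close> by its tangents at \<open>s = 1/2\<close> (up to \<open>0.62\<close>) and at \<open>s = 3/4\<close> (beyond)
  leaves quadratic inequalities.\<close>

lemma exp_endpoint:
  assumes "r / 2 \<le> s" "s \<le> r"
  shows "r^2 - (r^2 + r - 1) * s \<le> exp (- (2 * s)) * (r^2 + s)"
proof -
  have s: "0.4207 \<le> s" "s \<le> 0.841406" using assms r_gt r_less by auto
  have tangent: "exp (- c) * (1 - (2 * s - c)) \<le> exp (- (2 * s))" for c
  proof -
    have "1 - (2 * s - c) \<le> exp (- (2 * s - c))"
      using exp_ge_add_one_self[of "- (2 * s - c)"] by linarith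
    then have "exp (- c) * (1 - (2 * s - c)) \<le> exp (- c) * exp (- (2 * s - c))"
      by (rule mult_left_mono) simp
    also have "\<dots> = exp (- (2 * s))" by (simp flip: exp_add)
    finally show ?thesis .
  qed
  have "0.549365 * s \<le> (r^2 + r - 1) * s"
    using s r_gt r_power_bounds by (intro mult_right_mono) auto
  then have "r^2 - (r^2 + r - 1) * s \<le> 0.707965 - 0.549365 * s"
    using r_power_bounds(2) by simp
  also have "\<dots> \<le> exp (- (2 * s)) * (0.70796 + s)"
  proof (cases "s \<le> 0.62")
    case True
    have "1 / 2.72 \<le> 1 / exp (1::real)"
      using e_less_272 by (intro divide_left_mono) auto
    then have "0.3676 \<le> exp (- (1::real))" by (simp add: exp_minus inverse_eq_divide)
    then have "0.3676 * (2 - 2 * s) \<le> exp (- 1) * (1 - (2 * s - 1))"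
      using True by (intro mult_mono) auto
    also have "\<dots> \<le> exp (- (2 * s))" by (rule tangent)
    finally have "0.3676 * (2 - 2 * s) * (0.70796 + s) \<le> exp (- (2 * s)) * (0.70796 + s)"
      using s by (intro mult_right_mono) auto
    moreover have "0 \<le> (s - 0.4207) * (0.62 - s)" using s True by simp
    then have "0.707965 - 0.549365 * s \<le> 0.3676 * (2 - 2 * s) * (0.70796 + s)"
      using s by (simp add: field_simps)
    ultimately show ?thesis by simp
  next
    case False
    have "exp (0.5::real) ^ 2 = exp 1" by (simp add: power2_eq_square flip: exp_add)
    also have "\<dots> \<le> 1.65 ^ 2" using e_less_272 by (simp add: power2_eq_square)
    finally have "exp (0.5::real) \<le> 1.65" by (rule power2_le_imp_le) simp
    then have "exp (0.5::real) ^ 3 \<le> 1.65 ^ 3" by (intro power_mono) auto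
    then have "exp (1.5::real) \<le> 1 / 0.221"
      by (simp add: eval_nat_numeral flip: exp_add)
    then have "0.221 \<le> exp (- (1.5::real))" by (simp add: exp_minus field_simps)
    then have "0.221 * (2.5 - 2 * s) \<le> exp (- 1.5) * (1 - (2 * s - 1.5))"
      using s by (intro mult_mono) auto
    also have "\<dots> \<le> exp (- (2 * s))" by (rule tangent)
    finally have "0.221 * (2.5 - 2 * s) * (0.70796 + s) \<le> exp (- (2 * s)) * (0.70796 + s)"
      using s by (intro mult_right_mono) auto
    moreover have "0 \<le> (s - 0.62) * (0.841406 - s)" using s False by simp
    then have "0.707965 - 0.549365 * s \<le> 0.221 * (2.5 - 2 * s) * (0.70796 + s)"
      using s False by (simp add: field_simps)
    ultimately show ?thesis by simp
  qed
  also have "\<dots> \<le> exp (- (2 * s)) * (r^2 + s)"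
    using r_power_bounds by (intro mult_left_mono) auto
  finally show ?thesis .
qed

text \<open>The right side minus the left side has derivative \<open>(t\<^sup>2 - t + 1 - r) / t\<^sup>2\<close>, whose
  numerator has a root just below \<open>1/5\<close>. Above \<open>1/5\<close> monotonicity reduces the claim to
  \<open>t = 1 - r/2\<close>; below \<open>1/5\<close> the tangent of the logarithm at \<open>1/5\<close> suffices.\<close>

lemma ln_endpoint:
  assumes "1 - r \<le> t" "t \<le> 1 - r / 2"
  shows "(1 - t) * (1 + (1 - r) / t) \<le> - ln t"
proof (cases "t \<le> 1/5")
  case True
  have t: "0 < t" using assms r_less by simp
  have "exp (1.6::real) = exp 1 * exp 0.6" by (simp flip: exp_add)
  also have "\<dots> \<le> 2.72 * (1 + 0.6 + 0.6^2 / 2 + 0.6^3 / 4)"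
    using e_less_272 by (intro mult_mono exp_le_cubic) auto
  also have "\<dots> \<le> 5" by (simp add: eval_nat_numeral)
  finally have "1.6 \<le> ln (5::real)" by (subst ln_ge_iff) simp_all
  moreover have "ln (5 * t) \<le> 5 * t - 1" using t by (intro ln_le_minus_one) auto
  ultimately have "2.6 - 5 * t \<le> - ln t" using t by (simp add: ln_mult)
  moreover have "(1 - t) * (t + (1 - r)) \<le> (2.6 - 5 * t) * t"
  proof -
    have "0 \<le> (t - (1 - r)) * (1/5 - t)" using assms True by simp
    moreover have "0 \<le> (3 * r - 2.2) * (t - (1 - r))"
      using assms r_gt by (intro mult_nonneg_nonneg) auto
    moreover have "0 \<le> (1 - r) * (3 * r - 2.4)"
      using r_gt r_less by (intro mult_nonneg_nonneg) auto
    ultimately show ?thesis by (simp add: field_simps)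
  qed
  then have "(1 - t) * (1 + (1 - r) / t) \<le> 2.6 - 5 * t"
    using t by (simp add: field_simps)
  ultimately show ?thesis by simp
next
  case False
  define t1 where "t1 = 1 - r / 2"
  have t1: "0.579297 \<le> t1" "t1 \<le> 0.5792975" using r_gt r_less by (simp_all add: t1_def)
  define f where "f = (\<lambda>t. - ln t - (1 - t) * (1 + (1 - r) / t))"
  have "f t1 \<le> f t"
  proof (rule DERIV_nonpos_imp_nonincreasing[where f = f])
    show "t \<le> t1" using assms by (simp add: t1_def)
  next
    fix x assume x: "t \<le> x" "x \<le> t1"
    have pos: "1/5 < x" "x < 0.58" using x False t1 by auto
    have "(f has_real_derivative - (1 / x) - (- (1 + (1 - r) / x) + (1 - x) * (- (1 - r) / x^2))) (at x)"
      unfolding f_def using pos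
      by (auto intro!: derivative_eq_intros simp: power2_eq_square)
    moreover have "- (1 / x) - (- (1 + (1 - r) / x) + (1 - x) * (- (1 - r) / x^2))
        = (x^2 - x + (1 - r)) / x^2"
      using pos by (simp add: field_simps power2_eq_square)
    moreover have "0 \<le> (x - 1/5) * (4/5 - x)" using pos by simp
    then have "x^2 - x + (1 - r) \<le> 0"
      using r_gt by (simp add: field_simps power2_eq_square)
    then have "(x^2 - x + (1 - r)) / x^2 \<le> 0" by (simp add: divide_nonpos_nonneg)
    ultimately show "\<exists>y. (f has_real_derivative y) (at x) \<and> y \<le> 0" by auto
  qed
  moreover have "(1 - t1) * (1 + (1 - r) / t1) \<le> 0.536"
  proof -
    have "(1 - r) / t1 \<le> 0.158595 / 0.579297"
      using r_gt r_less t1 by (intro frac_le) auto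
    then have "(1 - t1) * (1 + (1 - r) / t1) \<le> 0.420703 * (1 + 0.158595 / 0.579297)"
      using t1 r_less by (intro mult_mono) auto
    also have "\<dots> \<le> 0.536" by simp
    finally show ?thesis .
  qed
  moreover have "0.536 \<le> - ln t1"
  proof -
    have "exp (0.536::real) \<le> 1 + 0.536 + 0.536^2 / 2 + 0.536^3 / 4"
      by (rule exp_le_cubic) auto
    also have "\<dots> \<le> 1 / 0.5792975" by (simp add: eval_nat_numeral)
    also have "\<dots> \<le> 1 / t1" using t1 by (intro divide_left_mono) auto
    finally have "0.536 \<le> ln (1 / t1)" using t1 by (subst ln_ge_iff) simp_all
    then show ?thesis using t1 by (simp add: ln_div)
  qed
  ultimately show ?thesis by (simp add: f_def)
qed

text \<open>If \<open>A \<le> e\<^bsup>-2s\<^esup>\<close>, the first bound on \<open>D\<close> is enough. Otherwise insert the second one and put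
  \<open>A = e\<^bsup>-z\<^esup>\<close>: the claim bounds a multiple of \<open>e\<^sup>z\<close> by an affine function of \<open>z\<close>, so only the
  endpoints \<open>A = 1 - s\<close> (\<open>ln_endpoint\<close>) and \<open>A = e\<^bsup>-2s\<^esup>\<close> (\<open>exp_endpoint\<close>) matter.\<close>

lemma ln_plus_ratio_le_large:
  assumes s: "r / 2 \<le> s" "s \<le> r" and A: "0 < A" "A \<le> 1 - s"
    and D: "D \<le> s * A" "D \<le> r^2 - (r^2 + r - 1) * s - r^2 * A"
  shows "ln A + D / A \<le> - s"
proof (cases "A \<le> exp (- (2 * s))")
  case True
  then have "ln A \<le> - (2 * s)" using A ln_mono[of A "exp (- (2 * s))"] by simp
  moreover have "D / A \<le> s" using D A by (simp add: pos_divide_le_eq)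
  ultimately show ?thesis by simp
next
  case False
  define p where "p = r^2 - (r^2 + r - 1) * s"
  have s1: "0 < s" "s < 1" using s r_gt r_less by auto
  have "(r^2 + r - 1) * s \<le> 0.549371 * 0.841406"
    using s s1 r_gt r_less r_power_bounds by (intro mult_mono) auto
  then have p: "0 < p" using r_power_bounds by (simp add: p_def)
  have lo: "exp (1 * (- ln (1 - s))) \<le> (r^2 - s) / p + 1 / p * (- ln (1 - s))"
  proof -
    have "s * (1 + (1 - r) / (1 - s)) \<le> - ln (1 - s)"
      using ln_endpoint[of "1 - s"] s by simp
    then have "s * (1 - s) + s * (1 - r) \<le> - ln (1 - s) * (1 - s)"
      using s1 by (simp add: field_simps)
    then have "p \<le> (r^2 - s - ln (1 - s)) * (1 - s)"
      by (simp add: p_def algebra_simps)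
    then have "1 / (1 - s) \<le> (r^2 - s - ln (1 - s)) / p"
      using p s1 by (simp add: field_simps)
    then show ?thesis using s1 by (simp add: exp_minus inverse_eq_divide diff_divide_distrib)
  qed
  have hi: "exp (1 * (2 * s)) \<le> (r^2 - s) / p + 1 / p * (2 * s)"
  proof -
    have "p \<le> exp (- (2 * s)) * (r^2 + s)" unfolding p_def by (rule exp_endpoint[OF s])
    then have "exp (2 * s) \<le> (r^2 + s) / p"
      using p by (simp add: exp_minus field_simps)
    then show ?thesis by (simp add: add_divide_distrib diff_divide_distrib)
  qed
  have "exp (1 * (- ln A)) \<le> (r^2 - s) / p + 1 / p * (- ln A)"
  proof (rule exp_le_affine[OF _ _ lo hi])
    show "- ln (1 - s) \<le> - ln A" using A s1 by simp
    have "exp (- (2 * s)) < A" using False by simp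
    then have "ln (exp (- (2 * s))) < ln A" using A(1) by (subst ln_less_cancel_iff) auto
    then show "- ln A \<le> 2 * s" by simp
  qed
  then have "p * (1 / A) \<le> p * ((r^2 - s) / p + 1 / p * (- ln A))"
    using A p by (intro mult_left_mono) (auto simp: exp_minus inverse_eq_divide)
  also have "\<dots> = r^2 - s - ln A" using p by (simp add: field_simps)
  finally have "p / A \<le> r^2 - s - ln A" by simp
  moreover have "D / A \<le> (p - r^2 * A) / A"
    using D A by (intro divide_right_mono) (auto simp: p_def)
  then have "D / A \<le> p / A - r^2" using A by (simp add: diff_divide_distrib)
  ultimately show ?thesis by simp
qed

text \<open>With \<open>C = E (X u(X))\<close> one has \<open>(1 - r) B = r C\<close>. The two bounds on \<open>C\<close> come from the tangent
  inequality \<open>u_large_tangent\<close> and from the nonpositive correlation of \<open>X\<close> with the decreasing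
  function \<open>u_large\<close> of \<open>X\<close>.\<close>

lemma (in prob_space) large_mean_bound:
  assumes rv [measurable]: "random_variable borel X" and X: "AE \<omega> in M. X \<omega> \<in> {0..1}"
    and m: "1/2 \<le> expectation X"
  shows "0 < expectation (\<lambda>\<omega>. u_large (X \<omega>))"
    and "ln (expectation (\<lambda>\<omega>. u_large (X \<omega>)))
      + (1 - r) * expectation (\<lambda>\<omega>. w_large (X \<omega>)) / expectation (\<lambda>\<omega>. u_large (X \<omega>))
      \<le> - r * expectation X"
proof -
  define m A C where "m = expectation X" and "A = expectation (\<lambda>\<omega>. u_large (X \<omega>))"
    and "C = expectation (\<lambda>\<omega>. X \<omega> * u_large (X \<omega>))"
  note [measurable] = weight_pair_measurable[OF weight_pair_large]
  have intX: "integrable M X"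
    using X by (intro integrable_const_bound[of _ 1]) auto
  have intU: "integrable M (\<lambda>\<omega>. u_large (X \<omega>))"
    by (rule integrable_weight(1)[OF weight_pair_large rv X])
  have "integrable M (\<lambda>\<omega>. w_large (X \<omega>) / lam)"
    using integrable_weight(2)[OF weight_pair_large rv X] by simp
  then have intC: "integrable M (\<lambda>\<omega>. X \<omega> * u_large (X \<omega>))"
    using lam_pos by (simp add: w_large_def)
  have B: "(1 - r) * expectation (\<lambda>\<omega>. w_large (X \<omega>)) = r * C"
    unfolding w_large_def C_def using r_less by (simp add: lam_def mult.assoc)
  have "expectation X \<le> expectation (\<lambda>_. 1)"
    using X intX by (intro integral_mono_AE) auto
  then have "m \<le> 1" by (simp add: m_def prob_space)
  then have s: "r / 2 \<le> r * m" "r * m \<le> r"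
    using m r_gt mult_left_mono[of "1/2" m r] mult_left_mono[of m 1 r] by (auto simp: m_def)
  have "expectation (\<lambda>_. exp (- (1 + r))) \<le> A"
    unfolding A_def using X intU r_gt
    by (intro integral_mono_AE) (auto simp: u_large_def mult_left_le)
  then have "exp (- (1 + r)) \<le> A" by (simp add: prob_space)
  then have A: "0 < A" using exp_gt_zero[of "- (1 + r)"] by linarith
  have "A \<le> expectation (\<lambda>\<omega>. 1 - r * X \<omega>)"
    unfolding A_def
  proof (intro integral_mono_AE)
    show "AE \<omega> in M. u_large (X \<omega>) \<le> 1 - r * X \<omega>"
      using X by eventually_elim (rule u_large_le)
  qed (use intX intU in auto)
  then have A1: "A \<le> 1 - r * m" using intX by (simp add: m_def prob_space)
  have "expectation (\<lambda>\<omega>. (r + X \<omega>) * u_large (X \<omega>)) \<le> expectation (\<lambda>\<omega>. r - (r^2 + r - 1) * X \<omega>)"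
  proof (intro integral_mono_AE)
    show "AE \<omega> in M. (r + X \<omega>) * u_large (X \<omega>) \<le> r - (r^2 + r - 1) * X \<omega>"
      using X by eventually_elim (rule u_large_tangent)
  qed (use intX intU intC in \<open>auto simp: distrib_right\<close>)
  also have "expectation (\<lambda>\<omega>. (r + X \<omega>) * u_large (X \<omega>)) = r * A + C"
    using intU intC by (simp add: distrib_right A_def C_def)
  also have "expectation (\<lambda>\<omega>. r - (r^2 + r - 1) * X \<omega>) = r - (r^2 + r - 1) * m"
    using intX by (simp add: m_def prob_space)
  finally have "r * (r * A + C) \<le> r * (r - (r^2 + r - 1) * m)"
    using r_gt by (intro mult_left_mono) auto
  then have D2: "r * C \<le> r^2 - (r^2 + r - 1) * (r * m) - r^2 * A"
    by (simp add: algebra_simps power2_eq_square)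
  \<comment> \<open>Chebyshev: \<open>(X - m) (u(X) - u(m)) \<le> 0\<close> pointwise, hence \<open>C \<le> m A\<close>.\<close>
  have "expectation (\<lambda>\<omega>. X \<omega> * u_large (X \<omega>) - m * u_large (X \<omega>) - u_large m * (X \<omega> - m)) \<le> expectation (\<lambda>_. 0)"
  proof (rule integral_mono)
    fix \<omega>
    have "(X \<omega> - m) * (u_large (X \<omega>) - u_large m) \<le> 0"
    proof (cases "X \<omega> \<le> m")
      case True
      then have "u_large m \<le> u_large (X \<omega>)" using r_gt by (simp add: u_large_def)
      with True show ?thesis by (intro mult_nonpos_nonneg) auto
    next
      case False
      then have "u_large (X \<omega>) \<le> u_large m" using r_gt by (simp add: u_large_def)
      with False show ?thesis by (intro mult_nonneg_nonpos) auto
    qed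
    then show "X \<omega> * u_large (X \<omega>) - m * u_large (X \<omega>) - u_large m * (X \<omega> - m) \<le> 0"
      by (simp add: algebra_simps)
  qed (use intX intU intC in auto)
  also have "expectation (\<lambda>\<omega>. X \<omega> * u_large (X \<omega>) - m * u_large (X \<omega>) - u_large m * (X \<omega> - m))
      = C - m * A"
    using intX intU intC by (simp add: C_def A_def m_def prob_space)
  finally have "r * C \<le> r * (m * A)" using r_gt by (intro mult_left_mono) auto
  then have "ln A + r * C / A \<le> - (r * m)"
    using s A A1 D2 by (intro ln_plus_ratio_le_large) (auto simp: mult.assoc)
  with A show "0 < expectation (\<lambda>\<omega>. u_large (X \<omega>))"
    and "ln (expectation (\<lambda>\<omega>. u_large (X \<omega>)))
      + (1 - r) * expectation (\<lambda>\<omega>. w_large (X \<omega>)) / expectation (\<lambda>\<omega>. u_large (X \<omega>))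
      \<le> - r * expectation X"
    unfolding B A_def m_def by simp_all
qed

section \<open>The bound for P(S <= 1)\<close>

theorem corollary1:
  fixes M :: "'a measure" and X :: "nat \<Rightarrow> 'a \<Rightarrow> real" and S :: "'a \<Rightarrow> real" and n :: nat
  assumes "prob_space M"
    and "n \<ge> 1"
    and "prob_space.indep_vars M (\<lambda>_. borel) X {1..n}"
    and "\<And>i. i \<in> {1..n} \<Longrightarrow> \<P>(\<omega> in M. 0 \<le> X i \<omega> \<and> X i \<omega> \<le> 1) = 1"
    and "S = (\<lambda>\<omega>. \<Sum>i = 1..n. X i \<omega>)"
  shows "(\<exists>!a::real. a \<in> {0<..1} \<and> a = exp (a - 2))
    \<and> 0.841405 \<le> r \<and> r < 0.841406
    \<and> \<P>(\<omega> in M. S \<omega> \<le> 1) \<le> exp (1 - r * prob_space.expectation M S)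
    \<and> ereal (prob_space.expectation M S) \<le> ereal (1 / r) * (1 - ln_ext (\<P>(\<omega> in M. S \<omega> \<le> 1)))"
proof -
  interpret prob_space M by fact
  have rv [measurable]: "random_variable borel (X i)" if "i \<in> {1..n}" for i
    using assms(3) that by (auto simp: indep_vars_def)
  have X: "AE \<omega> in M. X i \<omega> \<in> {0..1}" if "i \<in> {1..n}" for i
  proof -
    note [measurable] = rv[OF that]
    have "AE \<omega> in M. 0 \<le> X i \<omega> \<and> X i \<omega> \<le> 1"
      using assms(4)[OF that] by (subst (asm) prob_Collect_eq_1) measurable
    then show ?thesis by simp
  qed
  define small where "small = (\<lambda>i. expectation (X i) \<le> 1 / 2)"
  define u w where "u = (\<lambda>i. if small i then u_small else u_large)"
    and "w = (\<lambda>i. if small i then w_small else w_large)"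
  have P: "prob {\<omega> \<in> space M. (\<Sum>i=1..n. X i \<omega>) \<le> 1}
      \<le> exp (1 - r * (\<Sum>i=1..n. expectation (X i)))"
  proof (rule prob_sum_le_exp[where u = u and w = w])
    fix i assume i: "i \<in> {1..n}"
    show "weight_pair (u i) (w i)"
      by (simp add: u_def w_def weight_pair_small weight_pair_large)
    note small = small_mean_bound[OF rv[OF i] X[OF i]]
      and large = large_mean_bound[OF rv[OF i] X[OF i]]
    show "0 < expectation (\<lambda>\<omega>. u i (X i \<omega>))"
      using small(1) large(1) by (simp add: u_def small_def)
    show "ln (expectation (\<lambda>\<omega>. u i (X i \<omega>)))
        + (1 - r) * expectation (\<lambda>\<omega>. w i (X i \<omega>)) / expectation (\<lambda>\<omega>. u i (X i \<omega>))
        \<le> - r * expectation (X i)"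
      using small(2) large(2) by (simp add: u_def w_def small_def)
  qed (use assms(3) X in auto)
  have "integrable M (X i)" if "i \<in> {1..n}" for i
    using X[OF that] rv[OF that] by (intro integrable_const_bound[of _ 1]) auto
  then have "expectation S = (\<Sum>i=1..n. expectation (X i))"
    unfolding assms(5) by (rule Bochner_Integration.integral_sum)
  with P have bound: "prob {\<omega> \<in> space M. S \<omega> \<le> 1} \<le> exp (1 - r * expectation S)"
    by (simp add: assms(5))
  have "ereal (expectation S) \<le> ereal (1 / r) * (1 - ln_ext (prob {\<omega> \<in> space M. S \<omega> \<le> 1}))"
  proof (cases "prob {\<omega> \<in> space M. S \<omega> \<le> 1} = 0")
    case True
    then show ?thesis using r_gt by (simp add: ln_ext_def)
  next
    case False
    define p where "p = prob {\<omega> \<in> space M. S \<omega> \<le> 1}"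
    have p: "0 < p" using False measure_nonneg[of M] by (simp add: p_def less_le)
    have "ln p \<le> 1 - r * expectation S"
      using p bound ln_mono[of p "exp (1 - r * expectation S)"] by (simp add: p_def)
    then have "expectation S \<le> 1 / r * (1 - ln p)"
      using r_gt by (simp add: field_simps)
    then show ?thesis
      using p by (simp add: ln_ext_def one_ereal_def flip: p_def)
  qed
  then show ?thesis
    using fixed_point_ex1 r_gt r_less bound by simp
qed

end
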